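(* Let $\mathbf{k}>\mathbf{s}\ge1$ be integers and let $b_{\mathbf{s}},b_0$ be complex constants with $b_{\mathbf{s}}\ne0$. Suppose that the equation $$f''-\left(e^{\mathbf{k}z}+b_{\mathbf{s}}e^{\mathbf{s}z}+b_0\right)f=0$$ has a nonzero non-oscillatory solution $f$ of the form $$f(z)=\psi(e^{z/\mathbf{p}})\,e^{cz}\,e^{\chi(e^{z/\mathbf{p}})},$$ where $\mathbf{p}=1$ if $\mathbf{k}$ is even and $\mathbf{p}=2$ if $\mathbf{k}$ is odd, $c$ is a complex constant, $\chi$ is a Laurent polynomial, and $\psi$ is a polynomial with simple roots only of the form $\psi(z)=a_0+a_kz^k$ for some integer $k\ge1$ and constants $a_0,a_k$ with $a_0a_k\neq0$. Then $\mathbf{s}/\mathbf{k}=1/4$ or $\mathbf{s}/\mathbf{k}=2/4$ or $\mathbf{s}/\mathbf{k}=3/4$.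
   Context: Every solution $f$ of the equation is an entire function. $\lambda(f)$ denotes the exponent of convergence of the zeros of $f$; a solution $f$ is called non-oscillatory if $\lambda(f)<\infty$. The integer $k$ (the degree of $\psi$) is unrelated to the bold integer $\mathbf{k}$ in the equation. *)

theory Defs
  imports "HOL-Complex_Analysis.Complex_Analysis" "HOL-Library.Poly_Mapping"
begin

definition solves_ode :: "(complex \<Rightarrow> complex) \<Rightarrow> (complex \<Rightarrow> complex) \<Rightarrow> bool" where
  "solves_ode A f \<longleftrightarrow>
     f holomorphic_on UNIV \<and> (\<forall>z. (deriv ^^ 2) f z - A z * f z = 0)"

text \<open>Zeros are counted with multiplicity, and a zero at the origin is disregarded.
  The infimum is taken in the extended reals, so that it is infinite if no exponent
  makes the series converge. The definition is meaningful for entire functions that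
  do not vanish identically.\<close>

definition exponent_of_convergence :: "(complex \<Rightarrow> complex) \<Rightarrow> ereal" where
  "exponent_of_convergence f =
     Inf {ereal \<alpha> | \<alpha>. \<alpha> > 0 \<and>
       (\<lambda>z. real_of_int (zorder f z) * norm z powr (- \<alpha>)) summable_on {z. z \<noteq> 0 \<and> f z = 0}}"

definition non_oscillatory :: "(complex \<Rightarrow> complex) \<Rightarrow> bool" where
  "non_oscillatory f \<longleftrightarrow> exponent_of_convergence f < \<infinity>"

text \<open>A Laurent polynomial is a finitely supported family of coefficients indexed by
  the integers; its value is only meaningful away from the origin.\<close>

type_synonym laurent_poly = "int \<Rightarrow>\<^sub>0 complex"

definition laurent_eval :: "laurent_poly \<Rightarrow> complex \<Rightarrow> complex" where
  "laurent_eval q w = (\<Sum>i\<in>Poly_Mapping.keys q. Poly_Mapping.lookup q i * w powi i)"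

end

theory Submission imports Defs begin

text \<open>In the variable \<open>w = exp (z / p)\<close> the differential equation becomes an identity of Laurent
  polynomials for \<open>\<psi>\<close> and \<open>U = p c + w \<chi>' w\<close>, and comparing lowest terms shows that \<open>U\<close> is a
  polynomial. As \<open>w\<close> is coprime to \<open>1 + a w\<^sup>k\<close>, where \<open>a = a\<^sub>k / a\<^sub>0\<close>, one gets
  \<open>k + 2 U = Y = (1 + a w\<^sup>k) V\<close> for a polynomial \<open>V\<close>, and the identity turns into
  \<open>4 k V = Y\<^sup>2 + 2 w Y' + 2 k Y + e - 4 p\<^sup>2 (w\<^sup>2\<^sup>n + b w\<^sup>s)\<close> with \<open>2 n = p K\<close>, \<open>s = p S\<close> and a constant \<open>e\<close>.
  In positive degrees \<open>Y\<close> is therefore \<open>y w\<^sup>n\<close> times the binomial series of \<open>(1 + b w\<^sup>-\<^sup>t)\<^sup>1\<^sup>/\<^sup>2\<close>,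
  \<open>t = 2 n - s\<close>, which makes the coefficients of \<open>V\<close> explicit as well. Comparing both with
  \<open>Y = (1 + a w\<^sup>k) V\<close> in the few highest degrees leaves only \<open>2 s = n\<close>, \<open>s = n\<close> and \<open>2 s = 3 n\<close>.\<close>

section \<open>Polynomial identities and the operator w d/dw\<close>

lemma poly_eqI_off_zero:
  fixes P Q :: "complex poly"
  assumes "\<And>w. w \<noteq> 0 \<Longrightarrow> poly P w = poly Q w"
  shows "P = Q"
proof -
  \<comment> \<open>The extra factor w makes both sides agree at 0 too, and it cancels
    afterwards.\<close>
  have "poly ([:0, 1:] * P) = poly ([:0, 1:] * Q)"
    using assms by (auto simp: fun_eq_iff)
  then show ?thesis
    unfolding poly_eq_poly_eq_iff by simp
qed

text \<open>This is w d/dw. Under w = exp (z / p) it becomes p d/dz, and monomials are its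
  eigenvectors.\<close>

definition euler_deriv :: "complex poly \<Rightarrow> complex poly" where
  "euler_deriv P = pCons 0 (pderiv P)"

lemma poly_euler_deriv: "poly (euler_deriv P) w = w * poly (pderiv P) w"
  by (simp add: euler_deriv_def)

lemma coeff_euler_deriv: "coeff (euler_deriv P) i = of_nat i * coeff P i"
  by (cases i) (simp_all add: euler_deriv_def coeff_pderiv)

lemma euler_deriv_add: "euler_deriv (P + Q) = euler_deriv P + euler_deriv Q"
  by (rule poly_eqI) (simp add: coeff_euler_deriv algebra_simps)

lemma euler_deriv_smult: "euler_deriv (smult x P) = smult x (euler_deriv P)"
  by (rule poly_eqI) (simp add: coeff_euler_deriv)

lemma euler_deriv_const: "euler_deriv [:x:] = 0"
  by (simp add: euler_deriv_def)

lemma euler_deriv_monom: "euler_deriv (monom x k) = smult (of_nat k) (monom x k)"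
  by (rule poly_eqI) (simp add: coeff_euler_deriv)

section \<open>From the differential equation to a polynomial identity\<close>

lemma sum_powi_poly:
  fixes u :: "int \<Rightarrow> complex"
  assumes "finite I"
  shows "\<exists>N P. \<forall>w. w \<noteq> 0 \<longrightarrow> w ^ N * (\<Sum>i\<in>I. u i * w powi i) = poly P w"
  using assms
proof (induction I rule: finite_induct)
  case empty
  show ?case by (rule exI[of _ 0], rule exI[of _ 0]) simp
next
  case (insert i I)
  then obtain N P where NP: "\<And>w. w \<noteq> 0 \<Longrightarrow> w ^ N * (\<Sum>i\<in>I. u i * w powi i) = poly P w"
    by blast
  have eq: "w ^ nat (- i) * w powi i = w ^ nat i" if "w \<noteq> 0" for w :: complex
    using that by (auto simp: power_int_def simp flip: power_mult_distrib)
  have "w ^ (N + nat (- i)) * (\<Sum>i\<in>insert i I. u i * w powi i)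
      = poly (monom (u i) (N + nat i) + monom 1 (nat (- i)) * P) w" if w: "w \<noteq> 0" for w
  proof -
    have "w ^ (N + nat (- i)) * (\<Sum>i\<in>insert i I. u i * w powi i)
        = u i * w ^ N * (w ^ nat (- i) * w powi i)
          + w ^ nat (- i) * (w ^ N * (\<Sum>i\<in>I. u i * w powi i))"
      using insert.hyps by (simp add: power_add algebra_simps)
    then show ?thesis
      using eq[OF w] NP[OF w] by (simp add: poly_monom power_add)
  qed
  then show ?case by blast
qed

lemma has_field_derivative_poly_over_power:
  fixes L :: "complex \<Rightarrow> complex"
  assumes LP: "\<And>w. w \<noteq> 0 \<Longrightarrow> w ^ N * L w = poly P w" and w: "w \<noteq> 0"
  shows "(L has_field_derivative (w * poly (pderiv P) w - of_nat N * poly P w) / w ^ Suc N) (at w)"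
proof -
  have *: "((\<lambda>w. poly P w / w ^ N) has_field_derivative
      (w * poly (pderiv P) w - of_nat N * poly P w) / w ^ Suc N) (at w)"
  proof (cases N)
    case 0
    then show ?thesis using w by (auto intro!: derivative_eq_intros)
  next
    case (Suc m)
    have m: "of_nat m * w ^ (m - Suc 0) * w = of_nat m * w ^ m"
      by (cases m) auto
    have "poly (pderiv P) w * (w * w ^ m) - poly P w * (w ^ m + of_nat m * w ^ (m - Suc 0) * w)
        = (w * poly (pderiv P) w - of_nat (Suc m) * poly P w) * w ^ m"
      unfolding m by (simp add: algebra_simps)
    then show ?thesis
      using w unfolding Suc
      by (auto intro!: derivative_eq_intros simp: divide_simps simp del: of_nat_Suc)
  qed
  show ?thesis
    by (rule has_field_derivative_transform_within_open[OF *, of "- {0}"])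
      (use w LP in \<open>auto simp: field_simps\<close>)
qed

text \<open>If the solution had a pole of order \<open>N > 0\<close> at the origin, the term
  \<open>U\<^sup>2 \<psi>\<close> would have a pole of order \<open>2 N\<close> that nothing else cancels.\<close>

lemma riccati_solution_polynomial:
  fixes U :: "complex \<Rightarrow> complex" and P R0 R1 C \<psi> :: "complex poly"
  assumes \<psi>: "poly \<psi> 0 \<noteq> 0"
    and eq: "\<And>w. w \<noteq> 0 \<Longrightarrow>
      poly R0 w + U w * poly R1 w + (w * deriv U w + (U w)\<^sup>2) * poly \<psi> w = poly C w"
    and UP: "\<And>w. w \<noteq> 0 \<Longrightarrow> w ^ N * U w = poly P w"
  shows "\<exists>Q. \<forall>w. w \<noteq> 0 \<longrightarrow> U w = poly Q w"
  using UP
proof (induction N arbitrary: P)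
  case 0
  then show ?case by auto
next
  case (Suc N)
  let ?X = "monom 1 (Suc N) :: complex poly"
  \<comment> \<open>This is the given equation multiplied by w^(2 N + 2), which clears every
    denominator.\<close>
  have "?X * ?X * R0 + ?X * P * R1
      + (?X * ([:0, 1:] * pderiv P - of_nat (Suc N) * P) + P\<^sup>2) * \<psi> = ?X * ?X * C"
  proof (rule poly_eqI_off_zero)
    fix w :: complex
    assume w: "w \<noteq> 0"
    define x where "x = w ^ Suc N"
    have x: "x \<noteq> 0" and PU: "poly P w = x * U w"
      using w Suc.prems[OF w] by (simp_all add: x_def)
    have dU: "deriv U w = (w * poly (pderiv P) w - of_nat (Suc N) * poly P w) / (w * x)"
      using has_field_derivative_poly_over_power[of "Suc N" U P w, OF Suc.prems w]
      by (simp add: DERIV_imp_deriv x_def)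
    have D: "w * poly (pderiv P) w - of_nat (Suc N) * poly P w = x * (w * deriv U w)"
      using w x by (simp add: dU)
    have X: "poly ?X w = x"
      by (simp add: poly_monom x_def)
    have "poly (?X * ?X * R0 + ?X * P * R1
        + (?X * ([:0, 1:] * pderiv P - of_nat (Suc N) * P) + P\<^sup>2) * \<psi>) w
      = x * x * poly R0 w + x * poly P w * poly R1 w
        + (x * (w * poly (pderiv P) w - of_nat (Suc N) * poly P w) + (poly P w)\<^sup>2) * poly \<psi> w"
      by (simp add: X del: of_nat_Suc)
    also have "\<dots> = x * x * (poly R0 w + U w * poly R1 w + (w * deriv U w + (U w)\<^sup>2) * poly \<psi> w)"
      unfolding D unfolding PU by (simp add: power2_eq_square algebra_simps)
    also have "\<dots> = poly (?X * ?X * C) w"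
      using eq[OF w] by (simp add: poly_monom x_def)
    finally show "poly (?X * ?X * R0 + ?X * P * R1
        + (?X * ([:0, 1:] * pderiv P - of_nat (Suc N) * P) + P\<^sup>2) * \<psi>) w = poly (?X * ?X * C) w" .
  qed
  \<comment> \<open>At 0 every term containing \<open>?X\<close> vanishes and only
    \<open>P\<^sup>2 * \<psi>\<close> survives. So w divides \<open>P\<close>, and the bound on the
    pole order drops by one.\<close>
  from arg_cong[OF this, of "\<lambda>p. poly p 0"] have "poly P 0 = 0"
    using \<psi> by (simp add: poly_monom)
  then obtain P1 where P1: "P = pCons 0 P1"
    by (cases P) auto
  have "w ^ N * U w = poly P1 w" if "w \<noteq> 0" for w
    using Suc.prems[OF that] that by (simp add: P1)
  then show ?case by (rule Suc.IH)
qed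

text \<open>\<open>U\<close> is p times the logarithmic derivative in z of the zero-free factor exp
  (c z) exp (L w). Differentiating twice keeps this factor, and dividing by it leaves the
  identity.\<close>

lemma ode_exponential_ansatz:
  fixes L A f :: "complex \<Rightarrow> complex" and \<psi> :: "complex poly" and p :: nat
  assumes p: "p > 0"
    and L: "L holomorphic_on - {0}"
    and ode: "solves_ode A f"
    and f: "\<And>z. f z = poly \<psi> (exp (z / of_nat p)) * exp (c * z) * exp (L (exp (z / of_nat p)))"
    and w: "w = exp (z / of_nat p)"
    and U: "U = (\<lambda>w. of_nat p * c + w * deriv L w)"
  shows "poly (euler_deriv (euler_deriv \<psi>)) w + U w * poly (smult 2 (euler_deriv \<psi>)) w
      + (w * deriv U w + (U w)\<^sup>2) * poly \<psi> w
    = (of_nat p)\<^sup>2 * A z * poly \<psi> w"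
proof -
  define e where "e z = exp (z / of_nat p)" for z :: complex
  define g where "g z = exp (c * z) * exp (L (e z))" for z
  have dL: "(L has_field_derivative deriv L w) (at w)" if "w \<noteq> 0" for w
    using holomorphic_derivI[OF L, of w] that by (simp add: open_Compl)
  have "deriv L holomorphic_on - {0}"
    by (rule holomorphic_deriv[OF L]) (simp add: open_Compl)
  then have U_hol: "U holomorphic_on - {0}"
    unfolding U
    by (intro holomorphic_on_add holomorphic_on_mult holomorphic_on_const holomorphic_on_ident)
  have dU: "(U has_field_derivative deriv U w) (at w)" if "w \<noteq> 0" for w
    using holomorphic_derivI[OF U_hol, of w] that by (simp add: open_Compl)
  have e0: "e z \<noteq> 0" for z
    by (simp add: e_def)
  have de: "(e has_field_derivative e z / of_nat p) (at z)" for z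
    unfolding e_def using p by (auto intro!: derivative_eq_intros)
  have dLe: "((\<lambda>z. L (e z)) has_field_derivative deriv L (e z) * (e z / of_nat p)) (at z)" for z
    by (rule DERIV_chain2[OF dL[OF e0] de])
  have dUe: "((\<lambda>z. U (e z)) has_field_derivative deriv U (e z) * (e z / of_nat p)) (at z)" for z
    by (rule DERIV_chain2[OF dU[OF e0] de])
  have dpe: "((\<lambda>z. poly q (e z)) has_field_derivative poly (pderiv q) (e z) * (e z / of_nat p)) (at z)"
    for q z
    by (rule DERIV_chain2[OF poly_DERIV de])
  have dg: "(g has_field_derivative U (e z) / of_nat p * g z) (at z)" for z
    unfolding g_def using p
    by (auto intro!: derivative_eq_intros dLe simp: U field_simps)
  have f_eq: "f = (\<lambda>z. poly \<psi> (e z) * g z)"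
    by (auto simp: f g_def e_def)
  \<comment> \<open>\<open>h\<close> is p f' divided by \<open>g\<close>; likewise \<open>h'\<close>
    below is p^2 f'' divided by \<open>g\<close>.\<close>
  define h where "h z = poly (pderiv \<psi>) (e z) * e z + poly \<psi> (e z) * U (e z)" for z
  have df: "(f has_field_derivative h z * g z / of_nat p) (at z)" for z
    unfolding f_eq h_def using p
    by (auto intro!: derivative_eq_intros dpe de dg simp: field_simps)
  have dh: "(h has_field_derivative
     (poly (pderiv (pderiv \<psi>)) (e z) * (e z)\<^sup>2 + poly (pderiv \<psi>) (e z) * e z
       + poly (pderiv \<psi>) (e z) * e z * U (e z)
       + poly \<psi> (e z) * (e z * deriv U (e z))) / of_nat p) (at z)" for z
    unfolding h_def using p
    by (auto intro!: derivative_eq_intros dpe de dUe simp: field_simps power2_eq_square)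
  define h' where "h' z = poly (pderiv (pderiv \<psi>)) (e z) * (e z)\<^sup>2 + poly (pderiv \<psi>) (e z) * e z
       + poly (pderiv \<psi>) (e z) * e z * U (e z)
       + poly \<psi> (e z) * (e z * deriv U (e z)) + h z * U (e z)" for z
  have d2: "((\<lambda>z. h z * g z / of_nat p) has_field_derivative
     h' z * g z / (of_nat p)\<^sup>2) (at z)" for z
    unfolding h'_def using p by (auto intro!: derivative_eq_intros dh dg simp: field_simps power2_eq_square)
  have "deriv f = (\<lambda>z. h z * g z / of_nat p)"
    using df by (auto intro: DERIV_imp_deriv)
  then have "(deriv ^^ 2) f z =
     h' z * g z / (of_nat p)\<^sup>2"
    using DERIV_imp_deriv[OF d2] by (simp add: numeral_2_eq_2)
  moreover have "(deriv ^^ 2) f z = A z * (poly \<psi> (e z) * g z)"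
    using ode unfolding solves_ode_def f_eq by (metis eq_iff_diff_eq_0)
  moreover have "g z \<noteq> 0"
    by (simp add: g_def)
  ultimately have "h' z = (of_nat p)\<^sup>2 * A z * poly \<psi> (e z)"
    using p by (simp add: field_simps)
  moreover have "w = e z"
    by (simp add: w e_def)
  ultimately show ?thesis
    unfolding h'_def h_def
    by (simp add: poly_euler_deriv euler_deriv_def pderiv_pCons algebra_simps power2_eq_square)
qed

lemma laurent_eval_holomorphic: "laurent_eval q holomorphic_on - {0}"
  unfolding laurent_eval_def by (intro holomorphic_intros) auto

lemma ansatz_polynomial_identity:
  fixes f :: "complex \<Rightarrow> complex" and \<psi> :: "complex poly" and K S p :: nat and b b\<^sub>0 c :: complex
  assumes p: "p > 0" and \<psi>: "poly \<psi> 0 \<noteq> 0"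
    and ode: "solves_ode (\<lambda>z. exp (of_nat K * z) + b * exp (of_nat S * z) + b\<^sub>0) f"
    and f: "\<And>z. f z = poly \<psi> (exp (z / of_nat p)) * exp (c * z)
      * exp (laurent_eval q (exp (z / of_nat p)))"
  obtains Q where "euler_deriv (euler_deriv \<psi>) + smult 2 (Q * euler_deriv \<psi>)
      + (euler_deriv Q + Q\<^sup>2) * \<psi>
    = smult ((of_nat p)\<^sup>2) ((monom 1 (p * K) + monom b (p * S) + [:b\<^sub>0:]) * \<psi>)"
proof -
  let ?L = "laurent_eval q"
  define U where "U = (\<lambda>w. of_nat p * c + w * deriv ?L w)"
  define C where "C = smult ((of_nat p)\<^sup>2) ((monom 1 (p * K) + monom b (p * S) + [:b\<^sub>0:]) * \<psi>)"
  obtain N P where NP: "\<And>w. w \<noteq> 0 \<Longrightarrow> w ^ N * ?L w = poly P w"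
    using sum_powi_poly[of "Poly_Mapping.keys q" "Poly_Mapping.lookup q"]
    unfolding laurent_eval_def by (meson Poly_Mapping.finite_keys)
  have eq: "poly (euler_deriv (euler_deriv \<psi>)) w + U w * poly (smult 2 (euler_deriv \<psi>)) w
      + (w * deriv U w + (U w)\<^sup>2) * poly \<psi> w = poly C w" if w: "w \<noteq> 0" for w
  proof -
    \<comment> \<open>Every nonzero w is of the form exp (z / p), so the identity holds on the whole
      punctured plane.\<close>
    define z where "z = of_nat p * Ln w"
    have wz: "w = exp (z / of_nat p)"
      using p w by (simp add: z_def)
    have "w ^ (p * m) = exp (of_nat m * z)" for m
      using p unfolding wz by (simp add: exp_of_nat_mult[symmetric])
    then show ?thesis
      using ode_exponential_ansatz[OF p laurent_eval_holomorphic ode f wz U_def]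
      by (simp add: C_def poly_monom algebra_simps)
  qed
  \<comment> \<open>Since w^N L is the polynomial \<open>P\<close>, the function w^N (w L') is
    \<open>euler_deriv P\<close> minus N times \<open>P\<close>.\<close>
  have UP: "w ^ N * U w = poly (monom (of_nat p * c) N + euler_deriv P - smult (of_nat N) P) w"
    if w: "w \<noteq> 0" for w
  proof -
    have "deriv ?L w = (w * poly (pderiv P) w - of_nat N * poly P w) / w ^ Suc N"
      by (rule DERIV_imp_deriv[OF has_field_derivative_poly_over_power[OF NP w]])
    then show ?thesis
      using w by (simp add: U_def poly_monom poly_euler_deriv field_simps)
  qed
  obtain Q where Q: "\<And>w. w \<noteq> 0 \<Longrightarrow> U w = poly Q w"
    using riccati_solution_polynomial[OF \<psi> eq UP] by blast
  have dQ: "deriv U w = poly (pderiv Q) w" if w: "w \<noteq> 0" for w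
    by (rule DERIV_imp_deriv, rule has_field_derivative_transform_within_open[OF poly_DERIV, of "- {0}"])
      (use w Q in auto)
  have "euler_deriv (euler_deriv \<psi>) + smult 2 (Q * euler_deriv \<psi>) + (euler_deriv Q + Q\<^sup>2) * \<psi> = C"
  proof (rule poly_eqI_off_zero)
    fix w :: complex
    assume w: "w \<noteq> 0"
    show "poly (euler_deriv (euler_deriv \<psi>) + smult 2 (Q * euler_deriv \<psi>)
        + (euler_deriv Q + Q\<^sup>2) * \<psi>) w = poly C w"
      using eq[OF w] by (simp add: Q[OF w] dQ[OF w] poly_euler_deriv[of Q] algebra_simps)
  qed
  then show thesis
    using that by (simp add: C_def)
qed

section \<open>Divisibility by 1 + a w^k and the equation for the quotient\<close>

text \<open>For a binomial \<open>\<psi>\<close> both Euler derivatives are multiples of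
  \<open>monom a k\<close>, which is coprime to \<open>1 + monom a k\<close>. Hence the latter
  divides k + 2 Q.\<close>

lemma quotient_equation:
  fixes Q :: "complex poly" and a a\<^sub>0 b\<^sub>0 :: complex and k :: nat
  assumes k: "k \<ge> 1" and a0: "a\<^sub>0 \<noteq> 0"
    and \<psi>: "\<psi> = smult a\<^sub>0 (1 + monom a k)"
    and eq: "euler_deriv (euler_deriv \<psi>) + smult 2 (Q * euler_deriv \<psi>)
      + (euler_deriv Q + Q\<^sup>2) * \<psi> = smult \<gamma> ((B + [:b\<^sub>0:]) * \<psi>)"
  obtains V e where "smult (4 * of_nat k) V = ((1 + monom a k) * V)\<^sup>2
      + smult 2 (euler_deriv ((1 + monom a k) * V)) + smult (2 * of_nat k) ((1 + monom a k) * V)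
      + [:e:] - smult (4 * \<gamma>) B"
proof -
  define m where "m = monom a k"
  define R where "R = euler_deriv Q + Q\<^sup>2 - smult \<gamma> (B + [:b\<^sub>0:])"
  define \<kappa> :: "complex poly" where "\<kappa> = [:of_nat k:]"
  \<comment> \<open>The Bezout relation (1 + m) - m = 1 yields an explicit quotient: (1 + m) R = -
    \<kappa> m (\<kappa> + 2 Q) implies (1 + m) (\<kappa> (\<kappa> + 2 Q) + R) = \<kappa> (\<kappa>
    + 2 Q).\<close>
  define V where "V = \<kappa> + 2 * Q + smult (1 / of_nat k) R"
  define N where "N = 1 + m"
  define G where "G = smult \<gamma> (B + [:b\<^sub>0:])"
  have d1: "euler_deriv \<psi> = smult a\<^sub>0 (\<kappa> * m)"
    using euler_deriv_const[of 1]
    by (simp add: \<psi> euler_deriv_smult euler_deriv_add euler_deriv_monom m_def \<kappa>_def one_pCons)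
  have d2: "euler_deriv (euler_deriv \<psi>) = smult a\<^sub>0 (\<kappa> * \<kappa> * m)"
    by (simp add: d1 euler_deriv_smult euler_deriv_monom m_def \<kappa>_def mult.assoc)
  have \<psi>N: "\<psi> = smult a\<^sub>0 N"
    by (simp add: \<psi> N_def m_def)
  have s1: "smult 2 (Q * smult a\<^sub>0 P) = smult a\<^sub>0 (2 * (Q * P))" for P
    by (simp add: numeral_poly mult.commute)
  have s2: "smult \<gamma> ((B + [:b\<^sub>0:]) * smult a\<^sub>0 P) = smult a\<^sub>0 (G * P)" for P
    by (simp add: G_def mult.commute)
  have "smult a\<^sub>0 (\<kappa> * \<kappa> * m + 2 * (Q * (\<kappa> * m)) + (euler_deriv Q + Q\<^sup>2) * N) = smult a\<^sub>0 (G * N)"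
    using eq unfolding d2 unfolding d1 unfolding \<psi>N unfolding s1 s2
    unfolding mult_smult_right smult_add_right .
  from arg_cong[OF this, of "smult (inverse a\<^sub>0)"]
  have "\<kappa> * \<kappa> * m + 2 * (Q * (\<kappa> * m)) + (euler_deriv Q + Q\<^sup>2) * N = G * N"
    using a0 by simp
  then have R: "(1 + m) * R = - (\<kappa> * m * (\<kappa> + 2 * Q))"
    unfolding N_def R_def G_def[symmetric] by (simp add: algebra_simps)
  have \<kappa>V: "\<kappa> * V = \<kappa> * (\<kappa> + 2 * Q) + R"
    using k by (simp add: V_def \<kappa>_def smult_add_right)
  have k0: "\<kappa> \<noteq> 0"
    using k by (simp add: \<kappa>_def)
  have "\<kappa> * ((1 + m) * V) = (1 + m) * (\<kappa> * V)"
    by (simp add: algebra_simps)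
  also have "\<dots> = (1 + m) * \<kappa> * (\<kappa> + 2 * Q) + (1 + m) * R"
    unfolding \<kappa>V by (simp add: algebra_simps)
  also have "\<dots> = \<kappa> * (\<kappa> + 2 * Q)"
    unfolding R by (simp add: algebra_simps)
  finally have Y: "(1 + m) * V = \<kappa> + 2 * Q"
    using k0 by simp
  have "\<kappa> * V - \<kappa> * ((1 + m) * V) = R"
    unfolding Y \<kappa>V by simp
  then have R': "R = - (\<kappa> * m * V)"
    by (simp add: algebra_simps)
  have dY: "euler_deriv ((1 + m) * V) = 2 * euler_deriv Q"
    using euler_deriv_const[of "of_nat k"] euler_deriv_smult[of 2 Q]
    by (simp add: Y euler_deriv_add \<kappa>_def numeral_poly)
  \<comment> \<open>\<open>Q\<close> is eliminated through (1 + m) V = \<kappa> + 2 Q and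
    \<open>R\<close> through R = - \<kappa> m V. The leftover constants k^2 and
    \<open>- 4 * \<gamma> * b\<^sub>0\<close> make up \<open>e\<close>.\<close>
  have "((1 + m) * V)\<^sup>2 + 2 * euler_deriv ((1 + m) * V) + 2 * \<kappa> * ((1 + m) * V)
      - 4 * \<kappa> * V - 4 * (euler_deriv Q + Q\<^sup>2 - R) = - \<kappa>\<^sup>2 + 4 * (\<kappa> * ((1 + m) * V) - \<kappa> * V + R)"
    unfolding dY unfolding Y by (simp add: power2_eq_square algebra_simps)
  also have "\<dots> = - \<kappa>\<^sup>2"
    unfolding R' by (simp add: algebra_simps)
  finally have "4 * \<kappa> * V = ((1 + m) * V)\<^sup>2 + 2 * euler_deriv ((1 + m) * V)
      + 2 * \<kappa> * ((1 + m) * V) + \<kappa>\<^sup>2 - 4 * smult \<gamma> (B + [:b\<^sub>0:])"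
    unfolding R_def by (simp add: algebra_simps)
  moreover have "[:(of_nat k)\<^sup>2 - 4 * \<gamma> * b\<^sub>0:] = \<kappa>\<^sup>2 - 4 * smult \<gamma> [:b\<^sub>0:]"
    by (simp add: \<kappa>_def numeral_poly power2_eq_square)
  moreover have "smult 2 P = 2 * P" "smult (4 * \<gamma>) P = 4 * smult \<gamma> P"
    "smult (4 * of_nat k) P = 4 * \<kappa> * P" "smult (2 * of_nat k) P = 2 * \<kappa> * P" for P
    by (simp_all add: \<kappa>_def numeral_poly mult.commute)
  ultimately have "smult (4 * of_nat k) V = ((1 + monom a k) * V)\<^sup>2
      + smult 2 (euler_deriv ((1 + monom a k) * V)) + smult (2 * of_nat k) ((1 + monom a k) * V)
      + [:(of_nat k)\<^sup>2 - 4 * \<gamma> * b\<^sub>0:] - smult (4 * \<gamma>) B"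
    by (simp only: m_def[symmetric] smult_add_right distrib_left) (simp only: algebra_simps)
  then show thesis by (rule that)
qed

section \<open>The binomial series of the square root\<close>

text \<open>For \<open>t > 0\<close> these are the coefficients of (1 + b x^t)^(1/2), where x stands
  for 1 / w.\<close>

definition sqrt_coeff :: "nat \<Rightarrow> complex \<Rightarrow> nat \<Rightarrow> complex" where
  "sqrt_coeff t b j = (if t dvd j then ((1 / 2) gchoose (j div t)) * b ^ (j div t) else 0)"

lemma fps_compose_monomial_nth:
  fixes G :: "complex fps"
  assumes t: "t > 0"
  shows "fps_nth (G oo (fps_const b * fps_X ^ t)) j
    = (if t dvd j then fps_nth G (j div t) * b ^ (j div t) else 0)"
proof -
  have pow: "fps_nth ((fps_const b * fps_X ^ t) ^ i) j = (if j = t * i then b ^ i else 0)" for i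
  proof -
    have "(fps_const b * fps_X ^ t) ^ i = fps_const (b ^ i) * fps_X ^ (t * i)"
      by (simp add: power_mult_distrib fps_const_power power_mult)
    then show ?thesis
      by (simp only: fps_mult_left_const_nth fps_X_power_nth) simp
  qed
  have "fps_nth (G oo (fps_const b * fps_X ^ t)) j
      = (\<Sum>i = 0..j. if j = t * i then fps_nth G i * b ^ i else 0)"
    unfolding fps_compose_nth pow by (rule sum.cong) auto
  also have "\<dots> = (if t dvd j then fps_nth G (j div t) * b ^ (j div t) else 0)"
  proof (cases "t dvd j")
    case True
    then obtain i where i: "j = t * i" by blast
    have "(\<Sum>l = 0..j. if j = t * l then fps_nth G l * b ^ l else 0)
        = (\<Sum>l = 0..j. if l = i then fps_nth G l * b ^ l else 0)"
      by (rule sum.cong) (use t i in auto)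
    also have "\<dots> = fps_nth G i * b ^ i"
      using t i by (simp add: sum.delta)
    finally show ?thesis
      using t i by simp
  next
    case False
    then show ?thesis
      by (auto intro!: sum.neutral)
  qed
  finally show ?thesis .
qed

text \<open>The binomial series with exponent 1/2 squares to the one with exponent 1, which is 1 +
  x; substituting b x^t for x respects powers.\<close>

lemma sqrt_coeff_square:
  assumes t: "t > 0"
  shows "(Abs_fps (sqrt_coeff t b))\<^sup>2 = 1 + fps_const b * fps_X ^ t"
proof -
  let ?g = "fps_const b * fps_X ^ t :: complex fps"
  have g0: "fps_nth ?g 0 = 0"
    using t by simp
  have "Abs_fps (sqrt_coeff t b) = fps_binomial (1 / 2) oo ?g"
    by (rule fps_ext) (simp add: fps_compose_monomial_nth[OF t] sqrt_coeff_def)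
  then have "(Abs_fps (sqrt_coeff t b))\<^sup>2 = (fps_binomial (1 / 2) ^ 2) oo ?g"
    by (simp add: fps_compose_power[OF g0])
  also have "\<dots> = (1 + fps_X) oo ?g"
    by (simp add: fps_binomial_power fps_binomial_1)
  also have "\<dots> = 1 + ?g"
    using g0 by (simp add: fps_compose_add_distrib)
  finally show ?thesis .
qed

section \<open>Coefficients of Y and V counted from the top\<close>

lemma quotient_equation_coeff:
  fixes V Y :: "complex poly"
  assumes eq: "smult (4 * of_nat k) V = Y\<^sup>2 + smult 2 (euler_deriv Y) + smult (2 * of_nat k) Y
      + [:e:] - smult \<beta> (monom 1 (2 * n) + monom b s)"
    and i: "i > 0"
  shows "4 * of_nat k * coeff V i = coeff (Y\<^sup>2) i + 2 * of_nat i * coeff Y i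
      + 2 * of_nat k * coeff Y i - \<beta> * ((if 2 * n = i then 1 else 0) + (if s = i then b else 0))"
proof -
  have "coeff [:e:] i = 0"
    using i by (cases i) auto
  then show ?thesis
    using arg_cong[OF eq, of "\<lambda>p. coeff p i"] by (simp add: coeff_euler_deriv mult.assoc)
qed

text \<open>In positive degrees above \<open>degree Y\<close> the terms linear in \<open>Y\<close>
  and \<open>V\<close> vanish, so \<open>Y\<^sup>2\<close> must match \<beta> (w^(2n) + b w^s)
  there. Degrees 2 \<open>degree Y\<close> and \<open>2 * n\<close> decide.\<close>

lemma degree_of_quotient_equation:
  fixes V Y :: "complex poly"
  assumes k: "k \<ge> 1" and a: "a \<noteq> 0" and s: "0 < s" "s < 2 * n" and \<beta>: "\<beta> \<noteq> 0"
    and Y: "Y = (1 + monom a k) * V"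
    and eq: "smult (4 * of_nat k) V = Y\<^sup>2 + smult 2 (euler_deriv Y) + smult (2 * of_nat k) Y
      + [:e:] - smult \<beta> (monom 1 (2 * n) + monom b s)"
  shows "degree Y = n" "degree V + k = n" "(lead_coeff Y)\<^sup>2 = \<beta>" "lead_coeff Y \<noteq> 0"
proof -
  have dm: "degree (1 + monom a k) = k" 
    using k a by (subst degree_add_eq_right) (auto simp: degree_monom_eq)
  have m0: "1 + monom a k \<noteq> 0"
    using dm k by (metis degree_0 not_one_le_zero)
  note coeff_eq = quotient_equation_coeff[OF eq]
  have V0: "V \<noteq> 0"
  proof
    assume "V = 0"
    then show False
      using coeff_eq[of "2 * n"] s \<beta> by (simp add: Y)
  qed
  have dY: "degree Y = degree V + k"
    using m0 V0 by (simp add: Y degree_mult_eq dm)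
  have Y0: "Y \<noteq> 0"
    using m0 V0 by (simp add: Y)
  have lead: "coeff (Y\<^sup>2) (2 * degree Y) = (lead_coeff Y)\<^sup>2"
    using lead_coeff_power[of Y 2] by (simp add: degree_power_eq Y0)
  have "\<not> degree Y > n"
  proof
    assume "degree Y > n"
    moreover have "coeff V (2 * degree Y) = 0" "coeff Y (2 * degree Y) = 0"
      using dY k by (auto intro!: coeff_eq_0)
    ultimately have "coeff (Y\<^sup>2) (2 * degree Y) = 0"
      using coeff_eq[of "2 * degree Y"] s by simp
    then show False
      using lead Y0 by simp
  qed
  moreover have "\<not> degree Y < n"
  proof
    assume *: "degree Y < n"
    then have "coeff (Y\<^sup>2) (2 * n) = 0"
      by (intro coeff_eq_0) (simp add: degree_power_eq Y0)
    moreover have "coeff V (2 * n) = 0" "coeff Y (2 * n) = 0"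
      using dY * by (auto intro!: coeff_eq_0)
    ultimately show False
      using coeff_eq[of "2 * n"] s \<beta> by simp
  qed
  ultimately show dYn: "degree Y = n"
    by simp
  then show "degree V + k = n"
    using dY by simp
  show "lead_coeff Y \<noteq> 0"
    using Y0 by simp
  have "coeff V (2 * n) = 0" "coeff Y (2 * n) = 0"
    using dY dYn k s by (auto intro!: coeff_eq_0)
  then have "coeff (Y\<^sup>2) (2 * n) = \<beta>"
    using coeff_eq[of "2 * n"] s by simp
  then show "(lead_coeff Y)\<^sup>2 = \<beta>"
    using lead dYn by simp
qed

text \<open>Here \<open>v j\<close> is the coefficient of \<open>w\<^sup>n\<^sup>-\<^sup>j\<close> in \<open>V\<close>. In powers of \<open>1 / w\<close>, the reversal \<open>R\<close> of \<open>Y\<close> and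
  the square root \<open>G\<close> differ by \<open>w\<^sup>-\<^sup>n E\<close>, because \<open>Y\<^sup>2\<close> agrees with \<open>\<beta> (w\<^sup>2\<^sup>n + b w\<^sup>s)\<close> above degree \<open>n\<close>;
  as \<open>Y\<close> has no negative powers, the coefficients of \<open>E\<close> after the first are the negated tail of \<open>G\<close>.\<close>

lemma reversed_coefficients:
  fixes V Y :: "complex poly"
  assumes k: "k \<ge> 1" and a: "a \<noteq> 0" and s: "0 < s" "s < 2 * n" "s \<noteq> n" and \<beta>: "\<beta> \<noteq> 0"
    and Y: "Y = (1 + monom a k) * V"
    and eq: "smult (4 * of_nat k) V = Y\<^sup>2 + smult 2 (euler_deriv Y) + smult (2 * of_nat k) Y
      + [:e:] - smult \<beta> (monom 1 (2 * n) + monom b s)"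
  obtains y F v where "y \<noteq> 0" and "F = (\<lambda>j. y * sqrt_coeff (2 * n - s) b j)"
    and "k \<le> n" and "\<And>j. j < k \<Longrightarrow> v j = 0"
    and "\<And>j. j < n \<Longrightarrow> F j = v j + (if j + k \<le> n then a * v (j + k) else 0)"
    and "\<And>j. j < n \<Longrightarrow> 2 * of_nat k * v j = - (\<Sum>l<j. F l * F (n + j - l)) - of_nat j * F j"
    and "v n = F n - of_nat n - of_nat k"
proof -
  define y where "y = lead_coeff Y"
  define t where "t = 2 * n - s"
  define F where "F = (\<lambda>j. y * sqrt_coeff t b j)"
  define v where "v j = coeff V (n - j)" for j
  note deg = degree_of_quotient_equation[OF k a s(1,2) \<beta> Y eq]
  have y0: "y \<noteq> 0" and y2: "y\<^sup>2 = \<beta>" and dY: "degree Y = n" and dV: "degree V + k = n"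
    using deg by (simp_all add: y_def)
  have t: "t > 0"
    using s by (simp add: t_def)
  define G where "G = Abs_fps F"
  define R where "R = fps_of_poly (reflect_poly Y)"
  have G2: "G\<^sup>2 = fps_const \<beta> * (1 + fps_const b * fps_X ^ t)"
  proof -
    have "G = fps_const y * Abs_fps (sqrt_coeff t b)"
      by (rule fps_ext) (simp add: G_def F_def)
    then show ?thesis
      using sqrt_coeff_square[OF t, of b] by (simp add: power_mult_distrib y2 fps_const_power)
  qed
  have G2_nth: "fps_nth (G\<^sup>2) j = \<beta> * ((if j = 0 then 1 else 0) + (if j = t then b else 0))" for j
    unfolding G2 by (simp add: fps_X_power_iff)
  have R_nth: "fps_nth R j = (if j \<le> n then coeff Y (n - j) else 0)" for j
    by (simp add: R_def coeff_reflect_poly dY)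
  have "Y \<noteq> 0"
    using y0 y_def by auto
  then have R2_nth: "fps_nth (R\<^sup>2) j = (if j \<le> 2 * n then coeff (Y\<^sup>2) (2 * n - j) else 0)" for j
    by (simp add: R_def coeff_reflect_poly dY degree_power_eq flip: fps_of_poly_power reflect_poly_power)
  have F0: "F 0 = y"
    by (simp add: F_def sqrt_coeff_def)
  note coeff_eq = quotient_equation_coeff[OF eq]
  \<comment> \<open>For \<open>j < n\<close> the degree \<open>2 * n - j\<close> exceeds n, where
    \<open>Y\<close> and \<open>V\<close> have no coefficients.\<close>
  have low: "fps_nth (R\<^sup>2 - G\<^sup>2) j = 0" if "j < n" for j
  proof -
    have "coeff V (2 * n - j) = 0" "coeff Y (2 * n - j) = 0"
      using dY dV that by (auto intro!: coeff_eq_0)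
    moreover have "2 * n = 2 * n - j \<longleftrightarrow> j = 0" "s = 2 * n - j \<longleftrightarrow> j = t"
      using that s by (auto simp: t_def)
    ultimately show ?thesis
      using coeff_eq[of "2 * n - j"] that by (simp add: R2_nth G2_nth)
  qed
  define E where "E = fps_shift n (R\<^sup>2 - G\<^sup>2) * inverse (R + G)"
  have RG: "R\<^sup>2 - G\<^sup>2 = fps_X ^ n * fps_shift n (R\<^sup>2 - G\<^sup>2)"
    using low by (intro fps_ext) (auto simp: fps_X_power_mult_nth)
  \<comment> \<open>The constant term of \<open>R + G\<close> is 2 \<open>y\<close>, hence
    nonzero.\<close>
  have inv: "inverse (R + G) * (R + G) = 1"
    using y0 by (intro inverse_mult_eq_1) (simp add: R_nth G_def F0 y_def dY)
  have "R - G = (R\<^sup>2 - G\<^sup>2) * inverse (R + G)"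
    using inv by (simp add: power2_eq_square square_diff_square_factored mult.assoc mult.commute)
  then have RGE: "R - G = fps_X ^ n * E"
    unfolding E_def by (subst (asm) RG) (simp add: mult.assoc)
  have R_low: "coeff Y (n - j) = F j" if "j < n" for j
    using arg_cong[OF RGE, of "\<lambda>f. fps_nth f j"] that
    by (simp add: R_nth G_def fps_X_power_mult_nth)
  have E0: "fps_nth E 0 = coeff Y 0 - F n"
    using arg_cong[OF RGE, of "\<lambda>f. fps_nth f n"] by (simp add: R_nth G_def fps_X_power_mult_nth)
  have E_pos: "fps_nth E i = - F (n + i)" if "i > 0" for i
    using arg_cong[OF RGE, of "\<lambda>f. fps_nth f (n + i)"] that
    by (simp add: R_nth G_def fps_X_power_mult_nth)
  have "R\<^sup>2 - G\<^sup>2 = (R - G) * (2 * G + (R - G))"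
    by (simp add: power2_eq_square algebra_simps)
  then have diff: "R\<^sup>2 - G\<^sup>2 = fps_X ^ n * (2 * (E * G) + fps_X ^ n * E\<^sup>2)"
    unfolding RGE by (simp add: power2_eq_square algebra_simps)
  have EG: "fps_nth (E * G) j = fps_nth E 0 * F j - (\<Sum>l<j. F l * F (n + j - l))" for j
  proof -
    have "fps_nth (E * G) j = (\<Sum>l=0..j. F l * fps_nth E (j - l))"
      by (subst mult.commute) (simp add: fps_mult_nth G_def)
    also have "\<dots> = (\<Sum>l<j. F l * fps_nth E (j - l)) + F j * fps_nth E 0"
      by (simp add: atLeast0AtMost lessThan_Suc_atMost[symmetric])
    also have "(\<Sum>l<j. F l * fps_nth E (j - l)) = (\<Sum>l<j. - (F l * F (n + j - l)))"
      by (rule sum.cong) (auto simp: E_pos)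
    finally show ?thesis
      by (simp add: sum_negf algebra_simps)
  qed
  have main: "2 * of_nat k * v j = fps_nth (E * G) j + of_nat (n - j) * F j + of_nat k * F j"
    if j: "j < n" for j
  proof -
    have "fps_nth (R\<^sup>2 - G\<^sup>2) (n + j) = 2 * fps_nth (E * G) j"
      using j unfolding diff by (simp add: fps_X_power_mult_nth numeral_fps_const)
    moreover have ne: "2 * n \<noteq> n - j"
      using j by simp
    moreover have "2 * n - (n + j) = n - j" "s = n - j \<longleftrightarrow> n + j = t"
      using j s by (auto simp: t_def)
    ultimately have "coeff (Y\<^sup>2) (n - j) - \<beta> * (if s = n - j then b else 0) = 2 * fps_nth (E * G) j"
      using j by (simp add: R2_nth G2_nth)
    then have "4 * of_nat k * v j = 2 * fps_nth (E * G) j + 2 * of_nat (n - j) * F j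
        + 2 * of_nat k * F j"
      using coeff_eq[of "n - j"] j ne by (simp add: R_low v_def)
    then have "2 * (2 * of_nat k * v j) = 2 * (fps_nth (E * G) j + of_nat (n - j) * F j + of_nat k * F j)"
      by (simp add: algebra_simps)
    then show ?thesis
      by (simp only: mult_cancel_left) simp
  qed
  have kn: "k \<le> n" and n0: "n > 0"
    using dV k by auto
  have v_low: "v j = 0" if "j < k" for j
    using that dV kn unfolding v_def by (intro coeff_eq_0) auto
  \<comment> \<open>This is \<open>main\<close> at index 0, where \<open>v 0 = 0\<close> because
    \<open>k \<ge> 1\<close>. It fixes the one coefficient of \<open>E\<close> not given by the tail
    of \<open>G\<close>.\<close>
  have "fps_nth E 0 * y + of_nat n * y + of_nat k * y = 0"
    using main[OF n0] v_low[of 0] k unfolding EG by (simp add: F0)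
  then have "(fps_nth E 0 + of_nat n + of_nat k) * y = 0"
    by (simp add: algebra_simps)
  then have "fps_nth E 0 + of_nat n + of_nat k = 0"
    using y0 by simp
  then have E0': "fps_nth E 0 = - of_nat n - of_nat k"
    by (simp add: eq_diff_eq eq_neg_iff_add_eq_0 add_ac)
  have coeff_Y: "coeff Y (n - j) = v j + (if j + k \<le> n then a * v (j + k) else 0)" for j
  proof -
    \<comment> \<open>For \<open>j > n\<close> the truncated difference is 0, and the equivalence
      rests on \<open>k \<ge> 1\<close>.\<close>
    have "n - j < k \<longleftrightarrow> \<not> j + k \<le> n"
      using k by linarith
    then show ?thesis
      by (simp add: Y v_def distrib_right coeff_monom_mult)
  qed
  show thesis
  proof (rule that[OF y0 _ kn v_low])
    show "F = (\<lambda>j. y * sqrt_coeff (2 * n - s) b j)"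
      by (simp add: F_def t_def)
    show "F j = v j + (if j + k \<le> n then a * v (j + k) else 0)" if "j < n" for j
      using R_low[OF that] coeff_Y[of j] by simp
    show "2 * of_nat k * v j = - (\<Sum>l<j. F l * F (n + j - l)) - of_nat j * F j" if "j < n" for j
      unfolding main[OF that] EG E0' using that by (simp add: of_nat_diff algebra_simps)
    show "v n = F n - of_nat n - of_nat k"
      using E0 E0' coeff_Y[of n] k by (simp add: algebra_simps)
  qed
qed

section \<open>Binomial coefficients of 1/2 and three unsolvable systems\<close>

lemma half_gchoose_Suc:
  "of_nat (Suc i) * ((1 / 2 :: complex) gchoose Suc i) = (1 / 2 - of_nat i) * ((1 / 2) gchoose i)"
  by (simp only: gbinomial_absorption gbinomial_absorb_comp)

text \<open>The recursion multiplies by 1/2 - i, and 1/2 is not an integer.\<close>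

lemma half_gchoose_nonzero: "((1 / 2 :: complex) gchoose i) \<noteq> 0"
proof (induction i)
  case (Suc i)
  have "(1 / 2 :: complex) \<noteq> of_nat i"
  proof
    assume "(1 / 2 :: complex) = of_nat i"
    then have "of_nat (2 * i) = (of_nat 1 :: complex)"
      by (simp add: field_simps)
    then show False
      unfolding of_nat_eq_iff by presburger
  qed
  then show ?case
    using half_gchoose_Suc[of i] Suc.IH by (metis eq_iff_diff_eq_0 mult_eq_0_iff)
qed simp

lemma half_gchoose_values:
  "(1 / 2 :: complex) gchoose 2 = - 1 / 8"
  "(1 / 2 :: complex) gchoose 3 = 1 / 16"
  "(1 / 2 :: complex) gchoose 4 = - 5 / 128"
proof -
  have g2: "2 * ((1 / 2 :: complex) gchoose 2) = - 1 / 4"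
    using half_gchoose_Suc[of 1] by (simp add: numeral_2_eq_2)
  have g3: "3 * ((1 / 2 :: complex) gchoose 3) = - 3 / 2 * ((1 / 2) gchoose 2)"
    using half_gchoose_Suc[of 2] by (simp add: numeral_3_eq_3 numeral_2_eq_2)
  have g4: "4 * ((1 / 2 :: complex) gchoose 4) = - 5 / 2 * ((1 / 2) gchoose 3)"
    using half_gchoose_Suc[of 3] by (simp flip: numeral_eq_Suc)
  show "(1 / 2 :: complex) gchoose 2 = - 1 / 8"
    using g2 by algebra
  then show "(1 / 2 :: complex) gchoose 3 = 1 / 16"
    using g3 by algebra
  then show "(1 / 2 :: complex) gchoose 4 = - 5 / 128"
    using g4 by algebra
qed

text \<open>For nonzero z the exponent of 2 is odd on the left and even on the right.\<close>

lemma two_squares_ne_three_squares: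
  fixes x z :: nat
  assumes "2 * x\<^sup>2 = 3 * z\<^sup>2"
  shows "z = 0"
proof (rule ccontr)
  assume z: "z \<noteq> 0"
  then have x: "x \<noteq> 0"
    using assms by (cases "x = 0") simp_all
  have p: "prime_elem (2 :: nat)"
    by (simp add: two_is_prime_nat prime_elem_nat_iff)
  have "multiplicity 2 (2 * x\<^sup>2) = 1 + 2 * multiplicity 2 x"
    using x p by (simp add: prime_elem_multiplicity_mult_distrib prime_elem_multiplicity_power_distrib)
  moreover have "multiplicity 2 (3 * z\<^sup>2) = 2 * multiplicity 2 z"
    using z p by (simp add: prime_elem_multiplicity_mult_distrib prime_elem_multiplicity_power_distrib
        not_dvd_imp_multiplicity_0)
  ultimately have "1 + 2 * multiplicity 2 x = 2 * multiplicity 2 z"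
    by (simp only: assms)
  then show False
    by presburger
qed

lemma ratio_identity:
  fixes m r1 r2 :: complex
  assumes m: "m \<noteq> 0" "m + 1 \<noteq> 0"
    and r1: "m * r1 = 3 / 2 - m" and r2: "(m + 1) * r2 = 1 / 2 - m"
  shows "r1 * r2 + r1 / 2 - 1 / 8 = 3 * (m - 4) * (m - 1) / (8 * m * (m + 1))"
proof -
  have eqs: "r1 = (3 / 2 - m) / m" "r2 = (1 / 2 - m) / (m + 1)"
    using r1 r2 m by (simp_all add: eq_divide_eq mult.commute)
  have "4 + m * 4 \<noteq> 0"
    using m(2) by (metis add.commute distrib_left mult.commute mult.right_neutral mult_eq_0_iff
        zero_neq_numeral)
  then show ?thesis
    using m unfolding eqs by (simp add: divide_simps) (simp add: algebra_simps)
qed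

lemma ratio_shifted:
  fixes M :: nat and r1 r2 :: complex
  assumes "of_nat (M + 2) * r1 = - (of_nat M + 1 / 2)" "of_nat (M + 3) * r2 = - (of_nat M + 3 / 2)"
    and m: "m = of_nat (M + 2)"
  shows "m \<noteq> 0" "m + 1 \<noteq> 0" "m * r1 = 3 / 2 - m" "(m + 1) * r2 = 1 / 2 - m"
proof -
  have m1: "m + 1 = of_nat (M + 3)"
    by (simp add: m)
  show "m \<noteq> 0" "m + 1 \<noteq> 0"
    unfolding m1 unfolding m by (simp_all only: of_nat_eq_0_iff)
  show "m * r1 = 3 / 2 - m" "(m + 1) * r2 = 1 / 2 - m"
    unfolding m1 assms(2) unfolding m assms(1) by simp_all
qed

text \<open>These three systems arise in the case \<open>n = M t\<close>, \<open>M \<ge> 3\<close>, with \<open>k = t\<close> or \<open>k = 2 t\<close>. There \<open>x\<^sub>i\<close> is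
  \<open>v (i t) / (y b\<^sup>i)\<close>, the numbers \<open>r1\<close>, \<open>r2\<close> are quotients of consecutive binomial coefficients of \<open>1 / 2\<close>
  starting at index \<open>M + 1\<close>, and \<open>e\<close> is \<open>y b\<^sup>M / t\<close> times the first of these coefficients. The
  polynomial system for \<open>k = t\<close> has solutions with \<open>8 A\<^sup>2 = 3\<close>, but there \<open>M\<close> is irrational.\<close>

lemma no_solution_multiplier_one:
  fixes A e x2 x3 r1 r2 :: complex and M :: nat
  assumes A0: "A \<noteq> 0"
    and r1: "of_nat (M + 2) * r1 = - (of_nat M + 1 / 2)"
    and r2: "of_nat (M + 3) * r2 = - (of_nat M + 3 / 2)"
    and x1: "2 * A = - e - 1 / 2"
    and x2: "2 * x2 = - e * (r1 + 1 / 2) + 1 / 4" "x2 = A * (1 / 2 - A)"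
    and x3: "2 * x3 = - e * (r1 * r2 + r1 / 2 - 1 / 8) - 3 / 16" "x3 = A * (- 1 / 8 - x2)"
  shows False
proof -
  define m where "m = (of_nat (M + 2) :: complex)"
  define X where "X = 32 * A ^ 3 - 16 * A\<^sup>2 - 4 * A + 3"
  define D where "D = 8 * A * (1 - A)"
  note m = ratio_shifted[OF r1 r2 m_def]
  have e: "- e = (4 * A + 1) / 2"
    using x1 by (simp add: field_simps)
  have r1': "r1 = (3 / 2 - m) / m"
    using m by (simp add: eq_divide_eq mult.commute)
  have "2 * (D * m) = 2 * (3 * (4 * A + 1))"
    using x2(1) m(1) unfolding x2(2) e r1' D_def by (simp add: field_simps)
  then have Dm: "D * m = 3 * (4 * A + 1)"
    by (simp only: mult_cancel_left) simp
  have "(32 * x3 + 3) * (m * (m + 1)) = 3 * (4 * A + 1) * ((m - 4) * (m - 1))"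
    using x3(1) m(1,2) unfolding e ratio_identity[OF m]
    by (simp add: divide_simps) (simp add: algebra_simps)
  moreover have "32 * x3 + 3 = 32 * A ^ 3 - 16 * A\<^sup>2 - 4 * A + 3"
    by (simp add: x3(2) x2(2) power3_eq_cube power2_eq_square algebra_simps)
  ultimately have "m * ((32 * A ^ 3 - 16 * A\<^sup>2 - 4 * A + 3) * (m + 1)) = m * (D * ((m - 4) * (m - 1)))"
    unfolding Dm[symmetric] by (simp add: mult_ac)
  then have "(32 * A ^ 3 - 16 * A\<^sup>2 - 4 * A + 3) * (m + 1) = D * ((m - 4) * (m - 1))"
    using m by simp
  then have X: "X * (m + 1) = D * ((m - 4) * (m - 1))"
    by (simp only: X_def)
  \<comment> \<open>Multiplying by \<open>D\<close> makes m occur only through \<open>D * m\<close>,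
    which equals \<open>3 * (4 * A + 1)\<close>; this eliminates m.\<close>
  have "X * (D * m + D) = D * (X * (m + 1))"
    by (simp add: algebra_simps)
  also have "\<dots> = (D * m - 4 * D) * (D * m - D)"
    unfolding X by (simp add: algebra_simps)
  finally have "X * (D * m + D) = (D * m - 4 * D) * (D * m - D)" .
  then have "32 * A * (A - 1)\<^sup>2 * (8 * A\<^sup>2 - 3) = 0"
    unfolding Dm unfolding D_def X_def by algebra
  moreover have "A \<noteq> 1"
    using Dm by (auto simp: D_def)
  ultimately have A2: "8 * A\<^sup>2 = 3"
    using A0 by simp
  have "8 * A * m - 8 * A\<^sup>2 * m = 12 * A + 3"
    using Dm by (simp add: D_def algebra_simps power2_eq_square)
  then have Am: "A * (8 * m - 12) = 3 * (m + 1)"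
    unfolding A2 by (simp add: algebra_simps)
  \<comment> \<open>Squaring removes A, as A^2 = 3/8, and leaves an equation between
    integers.\<close>
  have "48 * (2 * m - 3)\<^sup>2 = 4 * (8 * A\<^sup>2) * (4 * m - 6)\<^sup>2"
    unfolding A2 by (simp add: power2_eq_square algebra_simps)
  also have "\<dots> = 8 * (A * (8 * m - 12))\<^sup>2"
    by (simp add: power2_eq_square algebra_simps)
  also have "\<dots> = 72 * (m + 1)\<^sup>2"
    unfolding Am by (simp add: power2_eq_square algebra_simps)
  finally have "24 * (2 * (2 * m - 3)\<^sup>2) = 24 * (3 * (m + 1)\<^sup>2)"
    by simp
  then have "2 * (2 * m - 3)\<^sup>2 = 3 * (m + 1)\<^sup>2"
    by (simp only: mult_cancel_left) simp
  moreover have "2 * m - 3 = of_nat (2 * M + 1)" "m + 1 = of_nat (M + 3)"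
    by (simp_all add: m_def)
  ultimately have "of_nat (2 * (2 * M + 1)\<^sup>2) = (of_nat (3 * (M + 3)\<^sup>2) :: complex)"
    by (simp only: of_nat_mult of_nat_power of_nat_numeral)
  then have "2 * (2 * M + 1)\<^sup>2 = 3 * (M + 3)\<^sup>2"
    unfolding of_nat_eq_iff .
  from two_squares_ne_three_squares[OF this] show False
    by simp
qed

lemma no_solution_multiplier_one_base:
  fixes A e x2 x3 r1 :: complex
  assumes r1: "5 * r1 = - 7 / 2" and x1: "2 * A = - e - 1 / 2"
    and x2: "2 * x2 = - e * (r1 + 1 / 2) + 1 / 4" "x2 = A * (1 / 2 - A)"
    and x3: "e * x3 = e / 16 + 4 * 5 / 128" "x3 = A * (- 1 / 8 - x2)"
  shows False
proof -
  have e: "e = - 2 * A - 1 / 2"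
    using x1 by simp
  have "r1 = 5 * r1 / 5"
    by simp
  then have r1': "r1 = - 7 / 10"
    unfolding r1 by simp
  \<comment> \<open>The quadratic and the quartic in A obtained here have no common root.\<close>
  have "80 * A\<^sup>2 - 56 * A + 6 = 0"
    using x2(1) unfolding e r1' x2(2) by (simp add: field_simps power2_eq_square)
  moreover have "1024 * A ^ 4 - 256 * A ^ 3 - 256 * A\<^sup>2 - 96 * A + 64 = 0"
    using x3(1) unfolding e x3(2) x2(2)
    by (simp add: field_simps power2_eq_square power3_eq_cube power4_eq_xxxx)
  ultimately show False
    by algebra
qed

lemma no_solution_multiplier_two:
  fixes e x2 x3 r1 r2 :: complex and M :: nat
  assumes r1: "of_nat (M + 2) * r1 = - (of_nat M + 1 / 2)"
    and r2: "of_nat (M + 3) * r2 = - (of_nat M + 3 / 2)"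
    and e: "e = - 1 / 2"
    and x2: "4 * x2 = - e * (r1 + 1 / 2) + 1 / 4"
    and x3: "4 * x3 = - e * (r1 * r2 + r1 / 2 - 1 / 8) - 3 / 16" "x3 = x2 / 2"
  shows False
proof -
  define m where "m = (of_nat (M + 2) :: complex)"
  note m = ratio_shifted[OF r1 r2 m_def]
  have "16 * x2 * m = 4 * m * (4 * x2)"
    by simp
  also have "\<dots> = 2 * (m * r1) + 2 * m"
    unfolding x2 e by (simp add: algebra_simps)
  also have "\<dots> = 3"
    unfolding m(3) by simp
  finally have x2m: "16 * x2 * m = 3" .
  define R where "R = r1 * r2 + r1 / 2 - 1 / 8"
  have R: "8 * m * (m + 1) * R = 3 * (m - 4) * (m - 1)"
    using m(1,2) unfolding R_def ratio_identity[OF m] by simp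
  have x2R: "16 * x2 = 4 * R - 3 / 2"
    using x3(1) unfolding x3(2) e R_def[symmetric] by (simp add: field_simps)
  have "16 * x2 * (2 * m * (m + 1)) = 8 * m * (m + 1) * R - 3 * m * (m + 1)"
    unfolding x2R by (simp add: algebra_simps)
  then have "16 * x2 * (2 * m * (m + 1)) = 3 * (m - 4) * (m - 1) - 3 * m * (m + 1)"
    unfolding R .
  moreover have "16 * x2 * (2 * m * (m + 1)) = 16 * x2 * m * (2 * (m + 1))"
    by (simp add: mult_ac)
  \<comment> \<open>The terms in m^2 cancel, and the remaining linear equation has the root m =
    1/4.\<close>
  ultimately have "3 * (2 * (m + 1)) = 3 * (m - 4) * (m - 1) - 3 * m * (m + 1)"
    unfolding x2m by simp
  then have "24 * m = 6"
    by (simp add: algebra_simps)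
  then have "of_nat (24 * (M + 2)) = (of_nat 6 :: complex)"
    by (simp add: m_def)
  then show False
    unfolding of_nat_eq_iff by simp
qed

section \<open>Case analysis on the two coefficient sequences\<close>

text \<open>In the application \<open>t\<close> is 2 n - s, so n < t means s < n and t < n means s >
  n. Index j refers to degree n - j.\<close>

locale reversed_system =
  fixes n k t :: nat and a b y :: complex and F v :: "nat \<Rightarrow> complex"
  assumes k: "k \<ge> 1" "k \<le> n" and t: "t > 0" and nonzero: "a \<noteq> 0" "b \<noteq> 0" "y \<noteq> 0"
    and F: "F = (\<lambda>j. y * sqrt_coeff t b j)"
    and v_low: "\<And>j. j < k \<Longrightarrow> v j = 0"
    and F_eq: "\<And>j. j < n \<Longrightarrow> F j = v j + (if j + k \<le> n then a * v (j + k) else 0)"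
    and v_eq: "\<And>j. j < n \<Longrightarrow> 2 * of_nat k * v j = - (\<Sum>l<j. F l * F (n + j - l)) - of_nat j * F j"
    and v_n: "v n = F n - of_nat n - of_nat k"
begin

lemma F_multiple: "F (i * t) = y * ((1 / 2) gchoose i) * b ^ i"
  using t by (simp add: F sqrt_coeff_def)

lemma F_0: "F 0 = y"
  using F_multiple[of 0] by simp

lemma F_t: "F t = y * b / 2"
  using F_multiple[of 1] by simp

lemma F_eq_0_iff: "F j = 0 \<longleftrightarrow> \<not> t dvd j"
  using nonzero half_gchoose_nonzero by (simp add: F sqrt_coeff_def)

lemma v_k: "a * v k = y"
  using F_eq[of 0] k v_low[of 0] by (simp add: F_0)

lemma v_k_nonzero: "v k \<noteq> 0"
  using v_k nonzero by auto

text \<open>\<open>F\<close> is supported on the multiples of \<open>t\<close>, and 0 is the only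
  one below \<open>j\<close>. The later variants, for \<open>j\<close> up to \<open>2 * t\<close>
  and \<open>3 * t\<close>, gain one term each.\<close>

lemma v_eq_1:
  assumes "j < n" "0 < j" "j \<le> t"
  shows "2 * of_nat k * v j = - (y * F (n + j)) - of_nat j * F j"
proof -
  have "(\<Sum>l<j. F l * F (n + j - l)) = (\<Sum>l\<in>{0}. F l * F (n + j - l))"
    using assms by (intro sum.mono_neutral_right) (auto simp: F_eq_0_iff dest: dvd_imp_le)
  then show ?thesis
    using v_eq[OF assms(1)] by (simp add: F_0)
qed

lemma multiple_less_cases:
  fixes l :: nat
  assumes "t dvd l" "l < 3 * t"
  shows "l = 0 \<or> l = t \<or> l = 2 * t"
proof -
  obtain i where i: "l = t * i"
    using assms by blast
  then have "i < 3"
    using assms t by simp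
  then show ?thesis
    using i by (auto simp: less_Suc_eq numeral_eq_Suc)
qed

lemma v_eq_2:
  assumes "j < n" "t < j" "j \<le> 2 * t"
  shows "2 * of_nat k * v j = - (y * F (n + j) + F t * F (n + j - t)) - of_nat j * F j"
proof -
  have "(\<Sum>l<j. F l * F (n + j - l)) = (\<Sum>l\<in>{0, t}. F l * F (n + j - l))"
    using assms multiple_less_cases
    by (intro sum.mono_neutral_right) (auto simp: F_eq_0_iff, fastforce)
  then show ?thesis
    using v_eq[OF assms(1)] t by (simp add: F_0)
qed

lemma v_eq_3:
  assumes "j < n" "2 * t < j" "j \<le> 3 * t"
  shows "2 * of_nat k * v j
    = - (y * F (n + j) + F t * F (n + j - t) + F (2 * t) * F (n + j - 2 * t)) - of_nat j * F j"
proof -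
  have "(\<Sum>l<j. F l * F (n + j - l)) = (\<Sum>l\<in>{0, t, 2 * t}. F l * F (n + j - l))"
    using assms multiple_less_cases
    by (intro sum.mono_neutral_right) (auto simp: F_eq_0_iff, fastforce)
  then show ?thesis
    using v_eq[OF assms(1)] t by (simp add: F_0 algebra_simps)
qed

text \<open>The indices \<open>l\<close> and \<open>n + j - l\<close> add up to
  \<open>n + j\<close>, so a nonzero product needs \<open>t dvd n + j\<close>; otherwise only the
  term with \<open>F j\<close> remains.\<close>

lemma v_support:
  assumes "j < n" "v j \<noteq> 0"
  shows "t dvd j \<or> t dvd n + j"
proof (rule ccontr)
  assume neg: "\<not> ?thesis"
  have "F l * F (n + j - l) = 0" if "l < j" for l
    using neg that dvd_add[of t l "n + j - l"] by (auto simp: F_eq_0_iff)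
  then have "(\<Sum>l<j. F l * F (n + j - l)) = 0"
    by (intro sum.neutral) auto
  then have "2 * of_nat k * v j = 0"
    using v_eq[OF assms(1)] neg F_eq_0_iff[of j] by simp
  then show False
    using assms k by simp
qed

text \<open>For \<open>0 < j < n\<close> only \<open>y * F (n + j)\<close> survives, so
  \<open>v j\<close> is nonzero just at j = t - n, which must be \<open>k\<close>. As
  \<open>F k = 0\<close>, also \<open>v (2 * k)\<close> is nonzero, which is possible only if 2 k =
  n.\<close>

lemma large_step:
  assumes "n < t" "t < 2 * n"
  shows "2 * t = 3 * n"
proof -
  have v_zero_iff: "v j = 0 \<longleftrightarrow> n + j \<noteq> t" if j: "0 < j" "j < n" for j
  proof -
    have "\<not> t dvd j"
      using j assms by (auto dest: dvd_imp_le)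
    then have "2 * of_nat k * v j = - (y * F (n + j))"
      using v_eq_1[of j] j assms F_eq_0_iff[of j] by simp
    moreover have "t dvd n + j \<longleftrightarrow> n + j = t"
    proof
      assume "t dvd n + j"
      then obtain i where "n + j = t * i" by blast
      moreover from this have "t * i < t * 2" "i \<noteq> 0"
        using j assms by (linarith, cases i) auto
      ultimately show "n + j = t"
        by (cases i) auto
    qed auto
    ultimately show ?thesis
      using k nonzero by (metis F_eq_0_iff mult_eq_0_iff neg_equal_0_iff_equal of_nat_eq_0_iff
          not_one_le_zero zero_neq_numeral)
  qed
  define r where "r = t - n"
  have r: "0 < r" "r < n" "n + r = t"
    using assms by (auto simp: r_def)
  have vr: "v r \<noteq> 0"
    using v_zero_iff[of r] r by simp
  then have kr: "k \<le> r"
    using v_low[of r] by force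
  then have "k = r"
    using v_zero_iff[of k] v_k_nonzero k r by auto
  have "F r = 0"
    using r assms by (auto simp: F_eq_0_iff dest: dvd_imp_le)
  then have "2 * r \<le> n" "v (2 * r) \<noteq> 0"
    using F_eq[of r] r vr nonzero \<open>k = r\<close> by (auto simp: mult_2 split: if_splits)
  then have "2 * r = n"
    using v_zero_iff[of "2 * r"] r by force
  then show ?thesis
    using r by simp
qed

text \<open>If \<open>t\<close> did not divide \<open>n\<close>, the nonzero coefficients would
  force \<open>t = 2 * k\<close>, and the values of \<open>v\<close> at k, 2 k and 3 k would then be
  overdetermined.\<close>

lemma small_step_dvd:
  assumes "t < n"
  shows "t dvd n"
proof (rule ccontr)
  assume ndvd: "\<not> t dvd n"
  \<comment> \<open>\<open>r\<close> is the smallest positive number with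
    \<open>t dvd n + r\<close>.\<close>
  define r where "r = t - n mod t"
  have r: "0 < r" "r < t"
    using t ndvd by (auto simp: r_def dvd_eq_mod_eq_0)
  have "n div t * t + n mod t = n" "n mod t < t"
    using t by simp_all
  then have "n + r = (n div t + 1) * t"
    unfolding r_def add_mult_distrib by linarith
  then have r_dvd: "t dvd n + r"
    by simp
  have not_dvd: "\<not> t dvd j" if "0 < j" "j < t" for j
    using that by (auto dest: dvd_imp_le)
  have "2 * of_nat k * v r = - (y * F (n + r))"
    using v_eq_1[of r] r assms not_dvd[OF r] F_eq_0_iff[of r] by simp
  then have "v r \<noteq> 0"
    using r_dvd nonzero F_eq_0_iff[of "n + r"] by auto
  then have kr: "k \<le> r"
    using v_low[of r] by force
  then have k_dvd: "t dvd n + k"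
    using v_support[of k] v_k_nonzero not_dvd[of k] k r assms by auto
  have kt: "k < t"
    using kr r by simp
  have F_nt: "F (n + t) = 0"
    using ndvd by (simp add: F_eq_0_iff)
  have v_t: "2 * of_nat k * v t = - of_nat t * F t"
    using v_eq_1[of t] assms t F_nt by simp
  then have "v t \<noteq> 0"
    using t nonzero by (auto simp: F_t)
  have "F (t - k) = 0"
    using not_dvd[of "t - k"] kt k by (simp add: F_eq_0_iff)
  then have "v (t - k) \<noteq> 0"
    using F_eq[of "t - k"] \<open>v t \<noteq> 0\<close> assms kt nonzero by auto
  then have "t dvd n + (t - k)"
    using v_support[of "t - k"] not_dvd[of "t - k"] kt k assms by auto
  \<comment> \<open>Combining the two divisibilities removes n and leaves a condition on 2 k
    alone.\<close>
  then have "t dvd (n + k) + t - (n + (t - k))"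
    using k_dvd by (intro dvd_diff_nat) auto
  also have "(n + k) + t - (n + (t - k)) = 2 * k"
    using kt by simp
  finally have tk: "t = 2 * k"
  proof
    fix i
    assume i: "2 * k = t * i"
    then have "t * i < t * 2" "i \<noteq> 0"
      using k kt by (linarith, cases i) auto
    then show "t = 2 * k"
      using i by (cases i) auto
  qed
  obtain m where m: "n + k = m * t"
    using k_dvd by (metis dvd_def mult.commute)
  then have n_eq: "n = (2 * m - 1) * k"
    using tk by (simp add: algebra_simps diff_mult_distrib)
  have m2: "m \<ge> 2"
  proof (rule ccontr)
    assume "\<not> m \<ge> 2"
    then have "m = 0 \<or> m = 1" by auto
    then show False
      using m tk assms k by auto
  qed
  then have n3: "3 * k \<le> n"
    unfolding n_eq by (intro mult_right_mono) auto
  have k0: "(of_nat k :: complex) \<noteq> 0"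
    using k by simp
  have not_dvd_odd: "\<not> t dvd k" "\<not> t dvd 3 * k"
    using not_dvd[of k] kt k by (simp_all add: tk)
  have "2 * of_nat k * v (2 * k) = 2 * of_nat k * (- (y * b / 2))"
    using v_t by (simp add: tk F_t[unfolded tk])
  then have v_2k: "v (2 * k) = - (y * b / 2)"
    unfolding mult_cancel_left using k0 by simp
  have "v k = - a * v (2 * k)"
    using F_eq[of k] n3 k not_dvd_odd by (simp add: F_eq_0_iff[of k, THEN iffD2] mult_2 eq_neg_iff_add_eq_0)
  then have "2 * (a * v k) = a\<^sup>2 * b * y"
    unfolding v_2k by (simp add: power2_eq_square mult_ac)
  then have a2b: "a\<^sup>2 * b = 2"
    unfolding v_k using nonzero by simp
  define c where "c = ((1 / 2 :: complex) gchoose m)"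
  define c' where "c' = ((1 / 2 :: complex) gchoose (m + 1))"
  have F_nk: "F (n + k) = y * c * b ^ m"
    unfolding m by (simp add: F_multiple c_def)
  have vk_eq: "2 * of_nat k * v k = - (y * (y * c * b ^ m))"
    using v_eq_1[of k] kt k assms not_dvd_odd by (simp add: F_nk F_eq_0_iff[of k, THEN iffD2])
  have "a * v (3 * k) = F t - v t"
    using F_eq[of t] assms n3 by (simp add: tk)
  then have v_3k: "a * v (3 * k) = y * b"
    using v_2k by (simp add: F_t tk[symmetric])
  show False
  \<comment> \<open>For \<open>n = 3 * k\<close> the index 3 k is the last one, where
    \<open>v_n\<close> replaces the formula valid below n.\<close>
  proof (cases "n = 3 * k")
    case True
    then have "m = 2"
      using m tk k by simp
    then have "2 * of_nat k * v k = y\<^sup>2 * b\<^sup>2 / 8"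
      using vk_eq by (simp add: c_def half_gchoose_values power2_eq_square)
    moreover have "v (3 * k) = - 4 * of_nat k"
      using v_n True not_dvd_odd by (simp add: F_eq_0_iff[of "3 * k", THEN iffD2])
    ultimately have v_k_eq: "2 * of_nat k * v k = y * b * (y * b) / 8" and yb: "y * b = - 4 * of_nat k * a"
      using v_3k by (simp_all add: power2_eq_square mult_ac)
    have "16 * of_nat k * (a * v k) = 8 * a * (2 * of_nat k * v k)"
      by simp
    also have "\<dots> = a * y * b * (y * b)"
      unfolding v_k_eq by (simp add: mult_ac)
    also have "\<dots> = - 4 * of_nat k * (a\<^sup>2 * b) * y"
      unfolding yb by (simp add: power2_eq_square mult_ac)
    finally have "16 * of_nat k * y = - 4 * of_nat k * (a\<^sup>2 * b) * y"
      unfolding v_k .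
    then show False
      using k0 nonzero unfolding a2b by simp
  next
    case False
    then have n3: "3 * k < n"
      using n3 by simp
    have "n + 3 * k = (m + 1) * t"
      using m tk by simp
    then have F_3k: "F (n + 3 * k) = y * c' * b ^ (m + 1)"
      by (simp only: F_multiple c'_def)
    have shift: "n + 3 * k - t = n + k"
      using tk by simp
    have "2 * of_nat k * v (3 * k) = - (y * F (n + 3 * k) + F t * F (n + 3 * k - t))
        - of_nat (3 * k) * F (3 * k)"
      using tk k by (intro v_eq_2 n3) auto
    then have v_3k_eq: "2 * of_nat k * v (3 * k) = - (y * (y * c' * b ^ (m + 1)) + y * b / 2 * (y * c * b ^ m))"
      unfolding F_3k shift F_nk F_t using not_dvd_odd by (simp add: F_eq_0_iff[of "3 * k", THEN iffD2])
    have "2 * of_nat k * (a * v (3 * k)) = a * (2 * of_nat k * v (3 * k))"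
      by simp
    also have "\<dots> = - (a * y\<^sup>2 * b ^ m * b * (c' + c / 2))"
      unfolding v_3k_eq by (simp add: power2_eq_square algebra_simps)
    finally have "2 * of_nat k * (a * v (3 * k)) = - (a * y\<^sup>2 * b ^ m * b * (c' + c / 2))" .
    then have 1: "2 * of_nat k * y * b = - (a * y\<^sup>2 * b ^ m * b * (c' + c / 2))"
      unfolding v_3k by (simp add: mult.assoc)
    have "2 * of_nat k * (a * v k) = a * (2 * of_nat k * v k)"
      by simp
    then have 2: "2 * of_nat k * y = - (a * y\<^sup>2 * b ^ m * c)"
      unfolding vk_eq v_k by (simp add: power2_eq_square mult_ac)
    \<comment> \<open>Indices k and 3 k give two expressions for 2 k y b. Equating them yields c' =
      c / 2, but the true ratio (1/2 - m) / (m + 1) equals 1/2 only for m = 0.\<close>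
    have "- ((a * y\<^sup>2 * b ^ m * b) * (c' + c / 2)) = 2 * of_nat k * y * b"
      unfolding 1 by simp
    also have "\<dots> = - ((a * y\<^sup>2 * b ^ m * b) * c)"
      unfolding 2 by (simp add: mult_ac)
    finally have "c' + c / 2 = c"
      using nonzero by simp
    then have c': "c' = c / 2"
      by (simp add: eq_diff_eq[symmetric])
    have "of_nat (m + 1) * c' = (1 / 2 - of_nat m) * c"
      using half_gchoose_Suc[of m] by (simp add: c_def c'_def)
    then have "of_nat (m + 1) / 2 * c = (1 / 2 - of_nat m) * c"
      unfolding c' by simp
    then have half: "of_nat (m + 1) / 2 = (1 / 2 - of_nat m :: complex)"
      unfolding mult_cancel_right by (simp add: c_def half_gchoose_nonzero)
    have "of_nat (3 * m) = 2 * (of_nat (m + 1) / 2) - 1 + 2 * (of_nat m :: complex)"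
      by (simp add: field_simps)
    then have "of_nat (3 * m) = (0 :: complex)"
      unfolding half by simp
    then show False
      using m2 by (simp only: of_nat_eq_0_iff)
  qed
qed

text \<open>With n = M t and k = q t only multiples of \<open>t\<close> matter, and dividing by
  \<open>y * b ^ i\<close> removes the scale. For \<open>M \<ge> 3\<close> the values
  \<open>x 1\<close>, \<open>x 2\<close>, \<open>x 3\<close> are overdetermined for every q.\<close>

lemma small_step:
  assumes "t < n"
  shows "n = 2 * t"
proof (rule ccontr)
  assume n2: "n \<noteq> 2 * t"
  obtain M where M: "n = M * t"
    using small_step_dvd[OF assms] by (metis dvd_def mult.commute)
  have M3: "M \<ge> 3"
  proof (rule ccontr)
    assume "\<not> M \<ge> 3"
    then have "M = 0 \<or> M = 1 \<or> M = 2" by auto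
    then show False
      using assms n2 M by auto
  qed
  have "t dvd k"
  proof (cases "k < n")
    case True
    then show ?thesis
      using v_support[OF True v_k_nonzero] M by (simp add: dvd_add_right_iff)
  next
    case False
    then show ?thesis
      using k M by auto
  qed
  then obtain q where q: "k = q * t"
    by (metis dvd_def mult.commute)
  have q1: "q \<ge> 1" and qM: "q \<le> M"
    using k t unfolding q M by (auto simp: Suc_le_eq)
  define T where "T = (of_nat t :: complex)"
  have T0: "T \<noteq> 0"
    using t by (simp add: T_def)
  define g where "g i = ((1 / 2 :: complex) gchoose i)" for i
  have g0: "g i \<noteq> 0" for i
    by (simp add: g_def half_gchoose_nonzero)
  have g_values: "g 1 = 1 / 2" "g (Suc 0) = 1 / 2" "g 2 = - 1 / 8" "g 3 = 1 / 16" "g 4 = - 5 / 128"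
    by (simp_all add: g_def half_gchoose_values)
  have F_it: "F (i * t) = y * g i * b ^ i" for i
    by (simp add: F_multiple g_def)
  define e where "e = y * b ^ M * g (M + 1) / T"
  define r1 where "r1 = g (M + 2) / g (M + 1)"
  define r2 where "r2 = g (M + 3) / g (M + 2)"
  define x where "x i = v (i * t) / (y * b ^ i)" for i
  define \<alpha> where "\<alpha> = a * b ^ q"
  have v_it: "v (i * t) = y * b ^ i * x i" for i
    using nonzero by (simp add: x_def)
  have r1: "of_nat (M + 2) * r1 = - (of_nat M + 1 / 2)"
    using half_gchoose_Suc[of "M + 1"] g0[of "M + 1"] by (simp add: r1_def g_def field_simps)
  have r2: "of_nat (M + 3) * r2 = - (of_nat M + 3 / 2)"
    using half_gchoose_Suc[of "M + 2"] g0[of "M + 2"]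
    by (simp add: r2_def g_def field_simps numeral_3_eq_3)
  have g1: "y * b ^ M * g (M + 1) = e * T"
    using T0 by (simp add: e_def)
  have g2: "y * b ^ M * g (M + 2) = e * T * r1"
    using T0 g0[of "M + 1"] by (simp add: e_def r1_def)
  have g3: "y * b ^ M * g (M + 3) = e * T * (r1 * r2)"
    using T0 g0[of "M + 1"] g0[of "M + 2"] by (simp add: e_def r1_def r2_def)
  have k_eq: "of_nat k = of_nat q * T"
    by (simp add: q T_def)
  have lt: "i * t < n \<longleftrightarrow> i < M" for i
    using t by (simp add: M)
  have shift: "n + i * t - l * t = (M + i - l) * t" for i l
    by (simp add: M diff_mult_distrib add_mult_distrib)
  have shift0: "n + i * t = (M + i) * t" for i
    by (simp add: M add_mult_distrib)
  have F_shift: "F (n + i * t - l * t) = y * g (M + i - l) * b ^ (M + i - l)" for i l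
    unfolding shift F_it ..
  have F_shift0: "F (n + i * t) = y * g (M + i) * b ^ (M + i)" for i
    unfolding shift0 F_it ..
  have x1: "2 * of_nat q * x 1 = - e - 1 / 2"
  proof -
    have "2 * (of_nat q * T) * (y * b * x 1) = - (y * (y * g (M + 1) * b ^ (M + 1))) - T * (y * b / 2)"
      using v_eq_1[of "1 * t"] lt[of 1] M3 t unfolding F_shift0 F_it v_it k_eq
      by (simp add: g_values T_def)
    also have "\<dots> = y * b * (- (y * b ^ M * g (M + 1)) - T / 2)"
      by (simp add: algebra_simps)
    also have "\<dots> = y * b * T * (- e - 1 / 2)"
      unfolding g1 by (simp add: algebra_simps)
    finally have "(y * b * T) * (2 * of_nat q * x 1) = (y * b * T) * (- e - 1 / 2)"
      by (simp add: algebra_simps)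
    then show ?thesis
      using nonzero T0 by simp
  qed
  have x2: "2 * of_nat q * x 2 = - e * (r1 + 1 / 2) + 1 / 4"
  proof -
    have "2 * (of_nat q * T) * (y * b\<^sup>2 * x 2)
        = - (y * (y * g (M + 2) * b ^ (M + 2)) + y * b / 2 * (y * g (M + 1) * b ^ (M + 1)))
          - 2 * T * (y * (- 1 / 8) * b\<^sup>2)"
      using v_eq_2[of "2 * t"] lt[of 2] M3 t F_shift[of 2 1] F_t
      unfolding F_shift0 F_it v_it k_eq by (simp add: g_values T_def)
    also have "\<dots> = y * b\<^sup>2 * (- (y * b ^ M * g (M + 2)) - (y * b ^ M * g (M + 1)) / 2 + T / 4)"
      by (simp add: algebra_simps power2_eq_square)
    also have "\<dots> = y * b\<^sup>2 * T * (- e * (r1 + 1 / 2) + 1 / 4)"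
      unfolding g1 g2 by (simp add: algebra_simps)
    finally have "(y * b\<^sup>2 * T) * (2 * of_nat q * x 2) = (y * b\<^sup>2 * T) * (- e * (r1 + 1 / 2) + 1 / 4)"
      by (simp add: algebra_simps)
    then show ?thesis
      using nonzero T0 by simp
  qed
  have x3: "2 * of_nat q * x 3 = - e * (r1 * r2 + r1 / 2 - 1 / 8) - 3 / 16" if "M > 3"
  proof -
    have "2 * (of_nat q * T) * (y * b ^ 3 * x 3)
        = - (y * (y * g (M + 3) * b ^ (M + 3)) + y * b / 2 * (y * g (M + 2) * b ^ (M + 2))
            + y * (- 1 / 8) * b\<^sup>2 * (y * g (M + 1) * b ^ (M + 1)))
          - 3 * T * (y * (1 / 16) * b ^ 3)"
      using v_eq_3[of "3 * t"] lt[of 3] that t F_shift[of 3 1] F_shift[of 3 2] F_t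
      unfolding F_shift0 F_it v_it k_eq by (simp add: g_values T_def)
    also have "\<dots> = y * b ^ 3 * (- (y * b ^ M * g (M + 3)) - (y * b ^ M * g (M + 2)) / 2
        + (y * b ^ M * g (M + 1)) / 8 - 3 * T / 16)"
      by (simp add: algebra_simps power_add power2_eq_square power3_eq_cube)
    also have "\<dots> = y * b ^ 3 * T * (- e * (r1 * r2 + r1 / 2 - 1 / 8) - 3 / 16)"
      unfolding g1 g2 g3 by (simp add: algebra_simps)
    finally have "(y * b ^ 3 * T) * (2 * of_nat q * x 3)
        = (y * b ^ 3 * T) * (- e * (r1 * r2 + r1 / 2 - 1 / 8) - 3 / 16)"
      by (simp add: algebra_simps)
    then show ?thesis
      using nonzero T0 by simp
  qed
  have rec: "g i = x i + \<alpha> * x j" if "i < M" "j = i + q" "j \<le> M" for i j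
  proof -
    have eq: "i * t + q * t = j * t" and le: "j * t \<le> n"
      using that by (simp_all add: M add_mult_distrib flip: add_mult_distrib)
    have "y * g i * b ^ i = y * b ^ i * x i + a * (y * b ^ j * x j)"
      using F_eq[of "i * t"] that(1) le unfolding lt q eq F_it v_it by simp
    then have "(y * b ^ i) * g i = (y * b ^ i) * (x i + \<alpha> * x j)"
      by (simp add: \<alpha>_def that(2) power_add algebra_simps)
    then show ?thesis
      using nonzero by simp
  qed
  have x_low: "x i = 0" if "i < q" for i
    using v_low[of "i * t"] that t by (simp add: x_def q)
  have \<alpha>: "\<alpha> * x q = 1"
    using rec[of 0 q] qM M3 q1 x_low[of 0] by (simp add: g_def)
  \<comment> \<open>For \<open>M = 3\<close> the index 3 t equals n, so \<open>v_n\<close> takes the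
    place of \<open>x3\<close>; \<open>y * b ^ 3\<close> is expressed by \<open>e\<close> through
    \<open>g 4\<close>.\<close>
  have last: "e * x 3 = e / 16 + (3 + of_nat q) * 5 / 128" if "M = 3"
  proof -
    have "y * b ^ 3 * x 3 = y * (1 / 16) * b ^ 3 - 3 * T - of_nat q * T"
      using v_n v_it[of 3] F_it[of 3] that by (simp add: M k_eq g_values T_def)
    moreover have "y * b ^ 3 * (- 5 / 128) = e * T"
      using g1 that by (simp add: g_values)
    ultimately have "T * (e * x 3) = T * (e / 16 + (3 + of_nat q) * 5 / 128)"
      by algebra
    then show ?thesis
      using T0 by simp
  qed
  have e_eq: "e = - 1 / 2" if "x 1 = 0"
  proof -
    have "e = - (- e - 1 / 2) - 1 / 2"
      by simp
    then show ?thesis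
      unfolding x1[symmetric] using that by simp
  qed
  consider "q = 1" | "q = 2" | "q \<ge> 3"
    using q1 by linarith
  then show False
  proof cases
    case 1
    \<comment> \<open>For q = 1 the number \<alpha> is 1 / A, so \<open>rec\<close> gives
      \<open>x 2\<close> and \<open>x 3\<close> as polynomials in A.\<close>
    define A where "A = x 1"
    have A0: "A \<noteq> 0" and A1: "\<alpha> * A = 1"
      using \<alpha> 1 by (auto simp: A_def)
    have A_mult: "A * (\<alpha> * z) = z" for z
      using A1 by (metis mult.assoc mult.commute mult_1)
    have "\<alpha> * x 2 = 1 / 2 - A" "\<alpha> * x 3 = - 1 / 8 - x 2"
      using rec[of 1 2] rec[of 2 3] M3 1 by (simp_all add: g_values A_def algebra_simps)
    then have A2: "x 2 = A * (1 / 2 - A)" and A3: "x 3 = A * (- 1 / 8 - x 2)"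
      using A_mult[of "x 2"] A_mult[of "x 3"] by simp_all
    have e1: "2 * A = - e - 1 / 2" and e2: "2 * x 2 = - e * (r1 + 1 / 2) + 1 / 4"
      using x1 x2 1 by (simp_all add: A_def)
    show False
    proof (cases "M = 3")
      case True
      have "5 * r1 = - 7 / 2"
        using r1 True by simp
      then show False
        by (rule no_solution_multiplier_one_base[OF _ e1 e2 A2 _ A3]) (use last[OF True] 1 in simp)
    next
      case False
      show False
        by (rule no_solution_multiplier_one[OF A0 r1 r2 e1 e2 A2 _ A3]) (use x3 False M3 1 in simp)
    qed
  next
    case 2
    have e: "e = - 1 / 2"
      by (rule e_eq) (use x_low[of 1] 2 in simp)
    have e2: "4 * x 2 = - e * (r1 + 1 / 2) + 1 / 4"
      using x2 2 by simp
    have "\<alpha> * x 2 = 1" "\<alpha> * x 3 = 1 / 2"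
      using \<alpha> rec[of 1 3] x_low[of 1] 2 M3 by (simp_all add: g_values)
    then have A3: "x 3 = x 2 / 2"
      by algebra
    show False
    proof (cases "M = 3")
      case True
      have r: "5 * r1 = - 7 / 2"
        using r1 True by simp
      have "160 * x 3 = 20 * (4 * x 2)"
        by (simp add: A3)
      also have "\<dots> = 2 * (5 * r1) + 10"
        unfolding e2 e by (simp add: field_simps)
      also have "\<dots> = 3"
        unfolding r by simp
      finally have x3_eq: "160 * x 3 = 3" .
      have "x 3 = 160 * x 3 / 160"
        by simp
      then have x3_val: "x 3 = 3 / 160"
        unfolding x3_eq .
      show False
        using last[OF True] unfolding 2 e x3_val by (simp add: complex_eq_iff)
    next
      case False
      show False
        by (rule no_solution_multiplier_two[OF r1 r2 e e2 _ A3]) (use x3 False M3 2 in simp)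
    qed
  next
    case 3
    have e: "e = - 1 / 2"
      by (rule e_eq) (use x_low[of 1] 3 in simp)
    \<comment> \<open>Both \<open>x 1\<close> and \<open>x 2\<close> vanish, which forces r1 = -1,
      contrary to (M + 2) r1 = - (M + 1/2).\<close>
    have "r1 = 2 * (- e * (r1 + 1 / 2) + 1 / 4) - 1"
      by (simp add: e field_simps)
    also have "\<dots> = - 1"
      unfolding x2[symmetric] using x_low[of 2] 3 by simp
    finally have "r1 = - 1" .
    then show False
      using r1 by simp
  qed
qed

end

section \<open>Reduction of the ratio S / K to a comparison of s with n\<close>

theorem theorem1p5:
  fixes K S p k :: nat
    and b\<^sub>S b\<^sub>0 c a\<^sub>0 a\<^sub>k :: complex
    and f :: "complex \<Rightarrow> complex"
    and \<psi> :: "complex poly"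
    and q :: laurent_poly
  assumes "S \<ge> 1" and "K > S"
    and "b\<^sub>S \<noteq> 0"
    and "p = (if even K then 1 else 2)"
    and "solves_ode (\<lambda>z. exp (of_nat K * z) + b\<^sub>S * exp (of_nat S * z) + b\<^sub>0) f"
    and "\<exists>z. f z \<noteq> 0"
    and "non_oscillatory f"
    and "\<forall>z. f z = poly \<psi> (exp (z / of_nat p)) * exp (c * z)
                  * exp (laurent_eval q (exp (z / of_nat p)))"
    and "rsquarefree \<psi>"
    and "k \<ge> 1" and "a\<^sub>0 * a\<^sub>k \<noteq> 0"
    and "\<psi> = [:a\<^sub>0:] + monom a\<^sub>k k"
  shows "real S / real K = 1 / 4 \<or> real S / real K = 2 / 4 \<or> real S / real K = 3 / 4"
proof -
  define a where "a = a\<^sub>k / a\<^sub>0"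
  define s where "s = p * S"
  have p: "p > 0"
    using assms(4) by (simp split: if_splits)
  \<comment> \<open>The choice of \<open>p\<close> makes \<open>p * K\<close> even, so that w^(p K)
    is the square of w^n.\<close>
  obtain n where n: "p * K = 2 * n"
    using assms(4) by (auto split: if_splits elim: evenE)
  have s: "0 < s" "s < 2 * n"
    using assms(1,2) p unfolding s_def n[symmetric] by auto
  have a0: "a\<^sub>0 \<noteq> 0" and a: "a \<noteq> 0"
    using assms(11) by (auto simp: a_def)
  have \<psi>: "\<psi> = smult a\<^sub>0 (1 + monom a k)"
    using a0 by (simp add: assms(12) a_def smult_add_right smult_monom one_pCons)
  have "poly \<psi> 0 \<noteq> 0"
    using a0 assms(10) by (simp add: assms(12) poly_monom power_0_left)
  then obtain Q where "euler_deriv (euler_deriv \<psi>) + smult 2 (Q * euler_deriv \<psi>)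
      + (euler_deriv Q + Q\<^sup>2) * \<psi>
    = smult ((of_nat p)\<^sup>2) ((monom 1 (p * K) + monom b\<^sub>S (p * S) + [:b\<^sub>0:]) * \<psi>)"
    using ansatz_polynomial_identity[OF p _ assms(5) assms(8)[rule_format]] by blast
  then obtain V e where "smult (4 * of_nat k) V = ((1 + monom a k) * V)\<^sup>2
      + smult 2 (euler_deriv ((1 + monom a k) * V)) + smult (2 * of_nat k) ((1 + monom a k) * V)
      + [:e:] - smult (4 * (of_nat p)\<^sup>2) (monom 1 (p * K) + monom b\<^sub>S (p * S))"
    by (rule quotient_equation[OF assms(10) a0 \<psi>])
  note eq = this[unfolded n s_def[symmetric]]
  have \<beta>: "4 * (of_nat p)\<^sup>2 \<noteq> (0 :: complex)"
    using p by simp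
  show ?thesis
  \<comment> \<open>\<open>s = n\<close> is the ratio 2/4; otherwise 2 n - s differs from n and one
    of the two step lemmas applies.\<close>
  proof (cases "s = n")
    case True
    then have "p * K = p * (2 * S)"
      using n by (simp add: s_def)
    then have "K = 2 * S"
      using p by simp
    then show ?thesis
      using assms(1) by simp
  next
    case False
    obtain y F v where y: "y \<noteq> 0" "F = (\<lambda>j. y * sqrt_coeff (2 * n - s) b\<^sub>S j)"
      and kn: "k \<le> n" and v: "\<And>j. j < k \<Longrightarrow> v j = 0"
      "\<And>j. j < n \<Longrightarrow> F j = v j + (if j + k \<le> n then a * v (j + k) else 0)"
      "\<And>j. j < n \<Longrightarrow> 2 * of_nat k * v j = - (\<Sum>l<j. F l * F (n + j - l)) - of_nat j * F j"
      "v n = F n - of_nat n - of_nat k"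
      using reversed_coefficients[OF assms(10) a s False \<beta> refl eq] by blast
    interpret reversed_system n k "2 * n - s" a b\<^sub>S y F v
      using assms(10,3) a s y kn v by unfold_locales auto
    \<comment> \<open>\<open>large_step\<close> covers s < n and gives 2 s = n, the ratio 1/4;
      \<open>small_step\<close> covers s > n and gives 2 s = 3 n, the ratio 3/4.\<close>
    have "4 * s = 2 * n \<or> 4 * s = 3 * (2 * n)"
      using large_step small_step s False by linarith
    then have "p * (4 * S) = p * K \<or> p * (4 * S) = p * (3 * K)"
      unfolding n[symmetric] s_def by (simp add: mult_ac)
    then have "4 * S = K \<or> 4 * S = 3 * K"
      using p by simp
    then have "4 * real S = real K \<or> 4 * real S = 3 * real K"
      by linarith
    then show ?thesis
      using assms(2) by (auto simp: field_simps)
  qed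
qed

end
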